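(* The functional $i(G)=1-\chi(G)$ on spheres can be extended to a multiplicative character on the additive group of spheres (the sphere group): the rule $i(G-H)=i(G)/i(H)$ gives a well-defined group homomorphism from the sphere group to $\{-1,1\}$.
   Context: All graphs are finite simple graphs, considered up to isomorphism. The Euler characteristic is $\chi(G)=\sum_{k\ge0}(-1)^k v_k$, where $v_k$ is the number of complete subgraphs with $k+1$ vertices. The unit sphere $S(x)$ of a vertex is the subgraph induced on the neighbors of $x$. A graph is contractible if it is the one-point graph $K_1$, or (inductively) if it has a vertex $x$ such that both $S(x)$ and the graph with $x$ removed are contractible. Spheres are defined inductively: the empty graph $0$ is the only $(-1)$-sphere; for $d\ge 0$, a $d$-sphere is a finite simple graph in which every unit sphere is a $(d-1)$-sphere and such that removing a vertex from it renders the remaining graph contractible. The (Zykov) join $G+H$ of two graphs is the disjoint union of $G$ and $H$ with all edges between a vertex of $G$ and a vertex of $H$ added. The join makes the set of spheres (of all dimensions $\geq -1$) a commutative monoid with neutral element $0$; the sphere group is its Grothendieck group, i.e. equivalence classes of formal differences $A-B$ of spheres, with $A-B\sim C-D$ if $A+D+K=B+C+K$ for some sphere $K$. *)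

theory Defs
  imports Complex_Main "HOL-Algebra.Sym_Groups"
begin

section \<open>Finite simple graphs\<close>

datatype 'a sgraph = SGraph (verts: "'a set") (edges: "'a set set")

definition simple_graph :: "'a sgraph \<Rightarrow> bool" where
  "simple_graph G \<longleftrightarrow>
     finite (verts G) \<and> (\<forall>e \<in> edges G. e \<subseteq> verts G \<and> card e = 2)"

definition graph_iso :: "'a sgraph \<Rightarrow> 'b sgraph \<Rightarrow> bool" where
  "graph_iso G H \<longleftrightarrow>
     (\<exists>f. bij_betw f (verts G) (verts H) \<and>
          (\<forall>x \<in> verts G. \<forall>y \<in> verts G. {x, y} \<in> edges G \<longleftrightarrow> {f x, f y} \<in> edges H))"

definition empty_graph :: "'a sgraph" where
  "empty_graph = SGraph {} {}"

definition induced_subgraph :: "'a sgraph \<Rightarrow> 'a set \<Rightarrow> 'a sgraph" where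
  "induced_subgraph G W = SGraph (verts G \<inter> W) {e \<in> edges G. e \<subseteq> W}"

definition unit_sphere :: "'a sgraph \<Rightarrow> 'a \<Rightarrow> 'a sgraph" where
  "unit_sphere G x = induced_subgraph G {y. {x, y} \<in> edges G}"

definition remove_vertex :: "'a sgraph \<Rightarrow> 'a \<Rightarrow> 'a sgraph" where
  "remove_vertex G x = induced_subgraph G (verts G - {x})"

definition zykov_join :: "'a sgraph \<Rightarrow> 'b sgraph \<Rightarrow> ('a + 'b) sgraph" where
  "zykov_join G H =
     SGraph (verts G <+> verts H)
       ((`) Inl ` edges G \<union> (`) Inr ` edges H \<union>
        {{Inl x, Inr y} | x y. x \<in> verts G \<and> y \<in> verts H})"

section \<open>Euler characteristic\<close>

definition complete_subgraphs :: "'a sgraph \<Rightarrow> nat \<Rightarrow> 'a set set" where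
  "complete_subgraphs G k =
     {K. K \<subseteq> verts G \<and> card K = k + 1 \<and> (\<forall>x \<in> K. \<forall>y \<in> K. x \<noteq> y \<longrightarrow> {x, y} \<in> edges G)}"

text \<open>
  A complete subgraph on \<open>k + 1\<close> vertices requires \<open>k < card (verts G)\<close>, so the alternating sum
  over all \<open>k\<close> is the finite sum below.
\<close>
definition euler_char :: "'a sgraph \<Rightarrow> int" where
  "euler_char G = (\<Sum>k < card (verts G). (-1) ^ k * int (card (complete_subgraphs G k)))"

definition i_functional :: "'a sgraph \<Rightarrow> int" where
  "i_functional G = 1 - euler_char G"

section \<open>Contractible graphs and spheres\<close>

inductive contractible :: "'a sgraph \<Rightarrow> bool" where
  one_point: "contractible (SGraph {x} {})"
| extend: "\<lbrakk>simple_graph G; x \<in> verts G; contractible (unit_sphere G x);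
            contractible (remove_vertex G x)\<rbrakk> \<Longrightarrow> contractible G"

inductive sphere_of_dim :: "int \<Rightarrow> 'a sgraph \<Rightarrow> bool" where
  empty: "sphere_of_dim (-1) empty_graph"
| step: "\<lbrakk>0 \<le> d; simple_graph G; \<forall>x \<in> verts G. sphere_of_dim (d - 1) (unit_sphere G x);
          \<exists>x \<in> verts G. contractible (remove_vertex G x)\<rbrakk> \<Longrightarrow> sphere_of_dim d G"

definition is_sphere :: "'a sgraph \<Rightarrow> bool" where
  "is_sphere G \<longleftrightarrow> (\<exists>d. sphere_of_dim d G)"

section \<open>The monoid of spheres up to isomorphism\<close>

text \<open>
  Every finite graph is isomorphic to one with natural numbers as vertices, so isomorphism
  classes are taken among those; the class is defined for a graph over any vertex type.
\<close>
definition iso_class :: "'a sgraph \<Rightarrow> nat sgraph set" where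
  "iso_class G = {H. simple_graph H \<and> graph_iso G H}"

text \<open>
  In the product, all the classes in the union coincide: the join respects isomorphism.
\<close>
definition sphere_monoid :: "nat sgraph set monoid" where
  "sphere_monoid =
     \<lparr>carrier = {iso_class G | G :: nat sgraph. is_sphere G},
      mult = (\<lambda>X Y. \<Union>G \<in> X. \<Union>H \<in> Y. iso_class (zykov_join G H)),
      one = iso_class (empty_graph :: nat sgraph)\<rparr>"

section \<open>Grothendieck group of a commutative monoid\<close>

definition grothendieck_rel :: "('a, 'b) monoid_scheme \<Rightarrow> (('a \<times> 'a) \<times> ('a \<times> 'a)) set" where
  "grothendieck_rel M =
     {((a, b), (c, d)) | a b c d.
        a \<in> carrier M \<and> b \<in> carrier M \<and> c \<in> carrier M \<and> d \<in> carrier M \<and>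
        (\<exists>k \<in> carrier M. a \<otimes>\<^bsub>M\<^esub> d \<otimes>\<^bsub>M\<^esub> k = b \<otimes>\<^bsub>M\<^esub> c \<otimes>\<^bsub>M\<^esub> k)}"

definition formal_difference :: "('a, 'b) monoid_scheme \<Rightarrow> 'a \<Rightarrow> 'a \<Rightarrow> ('a \<times> 'a) set" where
  "formal_difference M a b = grothendieck_rel M `` {(a, b)}"

text \<open>
  In the product, all the classes in the union coincide when \<open>M\<close> is a commutative monoid.
\<close>
definition grothendieck_group :: "('a, 'b) monoid_scheme \<Rightarrow> ('a \<times> 'a) set monoid" where
  "grothendieck_group M =
     \<lparr>carrier = (carrier M \<times> carrier M) // grothendieck_rel M,
      mult = (\<lambda>X Y. \<Union>(a, b) \<in> X. \<Union>(c, d) \<in> Y.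
                formal_difference M (a \<otimes>\<^bsub>M\<^esub> c) (b \<otimes>\<^bsub>M\<^esub> d)),
      one = formal_difference M \<one>\<^bsub>M\<^esub> \<one>\<^bsub>M\<^esub>\<rparr>"

section \<open>The sphere group\<close>

definition sphere_group :: "(nat sgraph set \<times> nat sgraph set) set monoid" where
  "sphere_group = grothendieck_group sphere_monoid"

definition sphere_diff :: "'a sgraph \<Rightarrow> 'b sgraph \<Rightarrow> (nat sgraph set \<times> nat sgraph set) set" where
  "sphere_diff G H = formal_difference sphere_monoid (iso_class G) (iso_class H)"

end

theory Submission
  imports Defs
begin

text \<open>
  For any graph, \<open>i(G) = 1 - \<chi>(G)\<close> is the sum of \<open>(-1)^|K|\<close> over all cliques \<open>K\<close>, the empty one
  included. A clique of a join is a disjoint union of a clique of each factor, so \<open>i\<close> is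
  multiplicative; splitting the cliques by whether they contain a vertex \<open>x\<close> gives
  \<open>i(G) = i(G - x) - i(S(x))\<close>, so by induction \<open>i\<close> vanishes on contractible graphs and is \<open>\<plusminus>1\<close> on
  spheres. The join of a contractible graph with any graph is contractible, which makes joins of
  spheres spheres. Hence \<open>i\<close> is a monoid homomorphism into the group \<open>{-1, 1}\<close>, and it extends to
  the Grothendieck group by the universal property.
\<close>

section \<open>Graph isomorphisms\<close>

text \<open>The witness of \<open>graph_iso\<close> is named so that one and the same map can be
  restricted to unit spheres and vertex deletions in the inductions below.\<close>

definition iso_map :: "('a \<Rightarrow> 'b) \<Rightarrow> 'a sgraph \<Rightarrow> 'b sgraph \<Rightarrow> bool" where
  "iso_map f G H \<longleftrightarrow> bij_betw f (verts G) (verts H) \<and>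
     (\<forall>x \<in> verts G. \<forall>y \<in> verts G. {x, y} \<in> edges G \<longleftrightarrow> {f x, f y} \<in> edges H)"

lemma graph_iso_iff: "graph_iso G H \<longleftrightarrow> (\<exists>f. iso_map f G H)"
  by (simp add: graph_iso_def iso_map_def)

lemma iso_map_inv:
  assumes "iso_map f G H"
  shows "iso_map (inv_into (verts G) f) H G"
proof -
  have b: "bij_betw f (verts G) (verts H)" using assms by (simp add: iso_map_def)
  have b': "bij_betw (inv_into (verts G) f) (verts H) (verts G)"
    by (rule bij_betw_inv_into[OF b])
  show ?thesis
    unfolding iso_map_def
  proof (intro conjI ballI b')
    fix x y assume xy: "x \<in> verts H" "y \<in> verts H"
    let ?g = "inv_into (verts G) f"
    have "?g x \<in> verts G" "?g y \<in> verts G" using b' xy by (auto simp: bij_betw_def)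
    moreover have "f (?g x) = x" "f (?g y) = y" using b xy by (auto simp: bij_betw_inv_into_right)
    ultimately show "{x, y} \<in> edges H \<longleftrightarrow> {?g x, ?g y} \<in> edges G"
      using assms by (simp add: iso_map_def)
  qed
qed

lemma graph_iso_sym: "graph_iso G H \<Longrightarrow> graph_iso H G"
  unfolding graph_iso_iff using iso_map_inv by blast

lemma iso_map_comp:
  assumes "iso_map f G H" "iso_map g H K"
  shows "iso_map (g \<circ> f) G K"
proof -
  have "f x \<in> verts H" if "x \<in> verts G" for x
    using assms(1) that by (auto simp: iso_map_def bij_betw_def)
  moreover have "bij_betw (g \<circ> f) (verts G) (verts K)"
    using assms bij_betw_trans unfolding iso_map_def by blast
  ultimately show ?thesis
    using assms by (simp add: iso_map_def)
qed

lemma graph_iso_trans: "graph_iso G H \<Longrightarrow> graph_iso H K \<Longrightarrow> graph_iso G K"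
  unfolding graph_iso_iff using iso_map_comp by blast

section \<open>Induced subgraphs and the restriction of isomorphisms to them\<close>

lemma verts_induced [simp]: "verts (induced_subgraph G W) = verts G \<inter> W"
  and edges_induced [simp]: "edges (induced_subgraph G W) = {e \<in> edges G. e \<subseteq> W}"
  by (simp_all add: induced_subgraph_def)

lemma simple_induced: "simple_graph G \<Longrightarrow> simple_graph (induced_subgraph G W)"
  by (auto simp: simple_graph_def)

lemma simple_unit_sphere: "simple_graph G \<Longrightarrow> simple_graph (unit_sphere G x)"
  by (simp add: unit_sphere_def simple_induced)

lemma simple_remove_vertex: "simple_graph G \<Longrightarrow> simple_graph (remove_vertex G x)"
  by (simp add: remove_vertex_def simple_induced)

lemma simple_edgeD:
  assumes "simple_graph G" "{x, y} \<in> edges G"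
  shows "x \<in> verts G" "y \<in> verts G" "x \<noteq> y"
proof -
  have "{x, y} \<subseteq> verts G" "card {x, y} = 2" using assms by (auto simp: simple_graph_def)
  then show "x \<in> verts G" "y \<in> verts G" "x \<noteq> y" by auto
qed

text \<open>Unit spheres and vertex deletions are both induced subgraphs, so transporting either of
  them reduces to finding the image of its vertex set under \<open>f\<close>.\<close>

lemma iso_map_induced:
  assumes "iso_map f G H" "W \<subseteq> verts G"
  shows "iso_map f (induced_subgraph G W) (induced_subgraph H (f ` W))"
proof -
  have b: "bij_betw f (verts G) (verts H)" using assms by (simp add: iso_map_def)
  have sub: "f ` W \<subseteq> verts H" using b assms(2) by (auto simp: bij_betw_def)
  have "bij_betw f W (f ` W)" using b assms(2) by (meson bij_betw_def bij_betw_subset)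
  moreover have "verts G \<inter> W = W" "verts H \<inter> f ` W = f ` W" using assms(2) sub by auto
  moreover have "\<forall>x \<in> W. \<forall>y \<in> W. {x, y} \<in> edges G \<longleftrightarrow> {f x, f y} \<in> edges H"
    using assms by (simp add: iso_map_def subset_iff)
  ultimately show ?thesis
    by (simp add: iso_map_def)
qed

lemma iso_map_unit_sphere:
  assumes "iso_map f G H" "simple_graph G" "simple_graph H" "x \<in> verts G"
  shows "iso_map f (unit_sphere G x) (unit_sphere H (f x))"
proof -
  have b: "bij_betw f (verts G) (verts H)" using assms by (simp add: iso_map_def)
  \<comment> \<open>Preserving adjacency is known only between vertices of \<open>G\<close>.
    Simplicity of both graphs puts all neighbors into the vertex sets, where it applies.\<close>
  have "f ` {y. {x, y} \<in> edges G} = {z. {f x, z} \<in> edges H}"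
  proof (intro equalityI subsetI)
    fix z assume "z \<in> f ` {y. {x, y} \<in> edges G}"
    then obtain y where "{x, y} \<in> edges G" "z = f y" by auto
    then show "z \<in> {z. {f x, z} \<in> edges H}"
      using assms simple_edgeD[of G x y] by (auto simp: iso_map_def)
  next
    fix z assume z: "z \<in> {z. {f x, z} \<in> edges H}"
    then have "z \<in> verts H" using assms simple_edgeD(2) by fastforce
    then obtain y where y: "y \<in> verts G" "z = f y" using b by (auto simp: bij_betw_def)
    then have "{x, y} \<in> edges G" using z assms by (auto simp: iso_map_def)
    then show "z \<in> f ` {y. {x, y} \<in> edges G}" using y by auto
  qed
  moreover have "{y. {x, y} \<in> edges G} \<subseteq> verts G" using assms(2) simple_edgeD(2) by fastforce
  ultimately show ?thesis
    using iso_map_induced[OF assms(1)] unfolding unit_sphere_def by metis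
qed

lemma iso_map_remove_vertex:
  assumes "iso_map f G H" "x \<in> verts G"
  shows "iso_map f (remove_vertex G x) (remove_vertex H (f x))"
proof -
  have b: "bij_betw f (verts G) (verts H)" using assms by (simp add: iso_map_def)
  have "f ` (verts G - {x}) = verts H - {f x}"
    using b assms(2) by (auto simp: bij_betw_def inj_on_def)
  then show ?thesis
    using iso_map_induced[OF assms(1), of "verts G - {x}"] unfolding remove_vertex_def by auto
qed

section \<open>Isomorphism invariance of contractible graphs and spheres\<close>

lemma sphere_of_dim_simple: "sphere_of_dim d G \<Longrightarrow> simple_graph G"
  by (induction rule: sphere_of_dim.induct) (auto simp: simple_graph_def empty_graph_def)

lemma single_vertex_graph:
  assumes "simple_graph G" "verts G = {z}"
  shows "G = SGraph {z} {}"
proof -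
  have "edges G = {}"
  proof (rule ccontr)
    assume "edges G \<noteq> {}"
    then obtain e where "e \<in> edges G" by auto
    then have "e \<subseteq> {z}" "card e = 2" using assms by (auto simp: simple_graph_def)
    then show False using card_mono[of "{z}" e] by simp
  qed
  then show ?thesis using assms(2) by (cases G) auto
qed

lemma empty_verts_graph:
  assumes "simple_graph G" "verts G = {}"
  shows "G = empty_graph"
proof -
  have "edges G = {}" using assms by (fastforce simp: simple_graph_def)
  then show ?thesis using assms(2) by (cases G) (auto simp: empty_graph_def)
qed

text \<open>The map restricts to the unit sphere and to the deletion, so the induction hypotheses
  apply to their images. Simplicity of \<open>H\<close> excludes edges that are not pairs of
  vertices, which an isomorphism does not see.\<close>

lemma contractible_iso:
  fixes G :: "'a sgraph" and H :: "'b sgraph"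
  assumes "contractible G" "iso_map f G H" "simple_graph H"
  shows "contractible H"
  using assms
proof (induction arbitrary: H rule: contractible.induct)
  case (one_point x)
  then have "verts H = {f x}" by (auto simp: iso_map_def bij_betw_def)
  then show ?case using single_vertex_graph[OF one_point(2)] contractible.one_point by metis
next
  case (extend G x)
  have "contractible (unit_sphere H (f x))"
    by (rule extend.IH(1)[OF
          iso_map_unit_sphere[OF extend.prems(1) extend.hyps(1) extend.prems(2) extend.hyps(2)]
          simple_unit_sphere[OF extend.prems(2)]])
  moreover have "contractible (remove_vertex H (f x))"
    by (rule extend.IH(2)[OF iso_map_remove_vertex[OF extend.prems(1) extend.hyps(2)]
          simple_remove_vertex[OF extend.prems(2)]])
  moreover have "f x \<in> verts H"
    using extend.prems(1) extend.hyps(2) by (auto simp: iso_map_def bij_betw_def)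
  ultimately show ?case using contractible.extend[OF extend.prems(2)] by blast
qed

lemma sphere_of_dim_iso:
  fixes G :: "'a sgraph" and H :: "'b sgraph"
  assumes "sphere_of_dim d G" "iso_map f G H" "simple_graph H"
  shows "sphere_of_dim d H"
  using assms
proof (induction arbitrary: H rule: sphere_of_dim.induct)
  case empty
  then have "verts H = {}" by (auto simp: iso_map_def bij_betw_def empty_graph_def)
  then show ?case using empty empty_verts_graph sphere_of_dim.empty by metis
next
  case (step d G)
  have im: "verts H = f ` verts G" using step.prems by (auto simp: iso_map_def bij_betw_def)
  have "\<forall>y \<in> verts H. sphere_of_dim (d - 1) (unit_sphere H y)"
    using step im iso_map_unit_sphere simple_unit_sphere by (metis (no_types, lifting) imageE)
  moreover have "\<exists>y \<in> verts H. contractible (remove_vertex H y)"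
    using step im iso_map_remove_vertex simple_remove_vertex contractible_iso
    by (metis (no_types, lifting) imageI)
  ultimately show ?case using sphere_of_dim.step step by blast
qed

lemma is_sphere_iso:
  "is_sphere G \<Longrightarrow> graph_iso G H \<Longrightarrow> simple_graph H \<Longrightarrow> is_sphere H"
  unfolding is_sphere_def graph_iso_iff using sphere_of_dim_iso by blast

section \<open>The reduced Euler characteristic as a sum over cliques\<close>

text \<open>All sizes are collected at once and the empty set counts as a clique; it supplies the
  summand 1 of 1 - \<chi>.\<close>

definition cliques :: "'a sgraph \<Rightarrow> 'a set set" where
  "cliques G = {K. K \<subseteq> verts G \<and> (\<forall>x \<in> K. \<forall>y \<in> K. x \<noteq> y \<longrightarrow> {x, y} \<in> edges G)}"

text \<open>For a finite graph this is minus the reduced Euler characteristic of the clique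
  complex.\<close>

definition clique_sum :: "'a sgraph \<Rightarrow> int" where
  "clique_sum G = (\<Sum>K \<in> cliques G. (-1) ^ card K)"

lemma finite_cliques: "finite (verts G) \<Longrightarrow> finite (cliques G)"
  by (rule finite_subset[of _ "Pow (verts G)"]) (auto simp: cliques_def)

lemma i_functional_eq_clique_sum:
  assumes fin: "finite (verts G)"
  shows "i_functional G = clique_sum G"
proof -
  let ?n = "card (verts G)"
  let ?C = "complete_subgraphs G"
  have sub: "?C k \<subseteq> cliques G" for k by (auto simp: complete_subgraphs_def cliques_def)
  have finC: "finite (?C k)" for k using sub finite_cliques[OF fin] finite_subset by blast
  \<comment> \<open>A nonempty clique \<open>K\<close> has index \<open>card K - 1\<close>, since
    index \<open>k\<close> stands for \<open>k + 1\<close> vertices; the index stays below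
    \<open>?n\<close> because \<open>K\<close> lies in the vertex set.\<close>
  have eq: "cliques G = insert {} (\<Union>k<?n. ?C k)"
  proof (intro equalityI subsetI)
    fix K assume K: "K \<in> cliques G"
    then have KV: "K \<subseteq> verts G" by (simp add: cliques_def)
    show "K \<in> insert {} (\<Union>k<?n. ?C k)"
    proof (cases "K = {}")
      case False
      then have "card K > 0" using KV fin by (meson card_gt_0_iff finite_subset)
      moreover have "card K \<le> ?n" using KV fin by (simp add: card_mono)
      ultimately have "card K - 1 < ?n" "K \<in> ?C (card K - 1)"
        using K by (auto simp: complete_subgraphs_def cliques_def)
      then show ?thesis by blast
    qed simp
  next
    fix K assume "K \<in> insert {} (\<Union>k<?n. ?C k)"
    moreover have "{} \<in> cliques G" by (simp add: cliques_def)
    ultimately show "K \<in> cliques G" using sub by auto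
  qed
  have nin: "{} \<notin> (\<Union>k<?n. ?C k)" by (auto simp: complete_subgraphs_def)
  have "clique_sum G = 1 + (\<Sum>K \<in> (\<Union>k<?n. ?C k). (-1) ^ card K)"
    unfolding clique_sum_def eq using nin finC by (subst sum.insert) auto
  also have "(\<Sum>K \<in> (\<Union>k<?n. ?C k). (-1) ^ card K) = (\<Sum>k<?n. \<Sum>K \<in> ?C k. (-1) ^ card K :: int)"
    by (rule sum.UNION_disjoint) (auto simp: finC, auto simp: complete_subgraphs_def)
  \<comment> \<open>The shift between the index \<open>k\<close> and the size \<open>k + 1\<close>
    turns the sign around, which produces the minus in 1 - \<chi>.\<close>
  also have "\<dots> = (\<Sum>k<?n. - ((-1) ^ k * int (card (?C k))))"
  proof (rule sum.cong)
    fix k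
    have "(\<Sum>K \<in> ?C k. (-1) ^ card K :: int) = (\<Sum>K \<in> ?C k. (-1) ^ (k + 1))"
      by (rule sum.cong) (auto simp: complete_subgraphs_def)
    then show "(\<Sum>K \<in> ?C k. (-1) ^ card K :: int) = - ((-1) ^ k * int (card (?C k)))" by simp
  qed simp
  also have "\<dots> = - euler_char G" by (simp add: euler_char_def sum_negf)
  finally show ?thesis by (simp add: i_functional_def)
qed

text \<open>Taking images under the isomorphism is a bijection between the two sets of cliques, and
  injectivity keeps the sizes.\<close>

lemma clique_sum_iso:
  assumes "iso_map f G H"
  shows "clique_sum G = clique_sum H"
proof -
  have b: "bij_betw f (verts G) (verts H)" using assms by (simp add: iso_map_def)
  then have inj: "inj_on f (verts G)" and im: "f ` verts G = verts H" by (auto simp: bij_betw_def)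
  have clique: "f ` K \<in> cliques H \<longleftrightarrow> K \<in> cliques G" if "K \<subseteq> verts G" for K
    using that assms im inj_onD[OF inj] unfolding cliques_def iso_map_def
    by (auto 0 3 simp: subset_iff)
  have "(`) f ` cliques G = cliques H"
  proof (intro equalityI subsetI)
    fix L assume L: "L \<in> cliques H"
    then obtain K where "K \<subseteq> verts G" "L = f ` K"
      using im unfolding cliques_def by (smt (verit) mem_Collect_eq subset_image_iff)
    then show "L \<in> (`) f ` cliques G" using clique L by auto
  qed (use clique in \<open>auto simp: cliques_def\<close>)
  moreover have "inj_on ((`) f) (cliques G)"
    using inj_on_image_Pow[OF inj] by (rule inj_on_subset) (auto simp: cliques_def)
  ultimately have "bij_betw ((`) f) (cliques G) (cliques H)" by (simp add: bij_betw_def)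
  then have "(\<Sum>K \<in> cliques G. (-1) ^ card (f ` K)) = clique_sum H"
    unfolding clique_sum_def by (rule sum.reindex_bij_betw)
  moreover have "card (f ` K) = card K" if "K \<in> cliques G" for K
    using that inj by (metis (mono_tags, lifting) card_image cliques_def inj_on_subset mem_Collect_eq)
  ultimately show ?thesis by (simp add: clique_sum_def)
qed

text \<open>Cliques avoiding \<open>x\<close> are those of the deletion. Cliques through
  \<open>x\<close> arise from those of the unit sphere by adding \<open>x\<close>, which raises the
  size by one and flips the sign.\<close>

lemma clique_sum_remove_vertex:
  assumes G: "simple_graph G" and x: "x \<in> verts G"
  shows "clique_sum G = clique_sum (remove_vertex G x) - clique_sum (unit_sphere G x)"
proof -
  let ?R = "cliques (remove_vertex G x)" and ?S = "cliques (unit_sphere G x)"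
  have fin: "finite (verts G)" using G by (simp add: simple_graph_def)
  have fR: "finite ?R" and fS: "finite ?S"
    using fin by (auto simp: remove_vertex_def unit_sphere_def intro!: finite_cliques)
  \<comment> \<open>A simple graph has no loops, so \<open>x\<close> is not among its own
    neighbors.\<close>
  have xS: "x \<notin> K" if "K \<in> ?S" for K
    using that simple_edgeD(3)[OF G, of x x] by (auto simp: cliques_def unit_sphere_def)
  have finS: "finite K" if "K \<in> ?S" for K
    using that fin finite_subset by (auto simp: cliques_def unit_sphere_def)
  have eq: "cliques G = ?R \<union> insert x ` ?S"
  proof (intro equalityI subsetI)
    fix K assume K: "K \<in> cliques G"
    show "K \<in> ?R \<union> insert x ` ?S"
    proof (cases "x \<in> K")
      case True
      then have "K - {x} \<in> ?S" using K by (auto simp: cliques_def unit_sphere_def)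
      moreover have "K = insert x (K - {x})" using True by auto
      ultimately show ?thesis by blast
    next
      case False
      then have "K \<in> ?R" using K by (auto simp: cliques_def remove_vertex_def)
      then show ?thesis by simp
    qed
  next
    fix K assume "K \<in> ?R \<union> insert x ` ?S"
    then show "K \<in> cliques G"
    proof
      assume "K \<in> insert x ` ?S"
      then show ?thesis using x by (auto simp: cliques_def unit_sphere_def insert_commute)
    qed (auto simp: cliques_def remove_vertex_def)
  qed
  have "x \<notin> K" if "K \<in> ?R" for K
    using that by (auto simp: cliques_def remove_vertex_def)
  then have disj: "?R \<inter> insert x ` ?S = {}" by blast
  have inj: "inj_on (insert x) ?S" using xS by (meson inj_onI insert_ident)
  have "clique_sum G = clique_sum (remove_vertex G x) + (\<Sum>K \<in> insert x ` ?S. (-1) ^ card K)"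
    unfolding clique_sum_def eq using fR fS disj by (simp add: sum.union_disjoint)
  also have "(\<Sum>K \<in> insert x ` ?S. (-1) ^ card K) = (\<Sum>K \<in> ?S. (-1) ^ card (insert x K) :: int)"
    using inj by (simp add: sum.reindex)
  also have "\<dots> = (\<Sum>K \<in> ?S. - ((-1) ^ card K))"
    using xS finS by (intro sum.cong) auto
  finally show ?thesis by (simp add: clique_sum_def sum_negf)
qed

text \<open>For one point the empty clique and the point cancel; in the inductive case both terms of
  the vertex recursion vanish.\<close>

lemma clique_sum_contractible: "contractible G \<Longrightarrow> clique_sum G = 0"
proof (induction rule: contractible.induct)
  case (one_point x)
  have "cliques (SGraph {x} {}) = {{}, {x}}" by (auto simp: cliques_def)
  then show ?case by (simp add: clique_sum_def)
next
  case (extend G x)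
  then show ?case by (simp add: clique_sum_remove_vertex)
qed

lemma clique_sum_empty: "clique_sum empty_graph = 1"
proof -
  have "cliques (empty_graph :: 'a sgraph) = {{}}" by (auto simp: cliques_def empty_graph_def)
  then show ?thesis by (simp add: clique_sum_def)
qed

text \<open>At a vertex whose deletion is contractible the recursion leaves only minus the value on
  the unit sphere, a sphere of one dimension less.\<close>

lemma clique_sum_sphere: "sphere_of_dim d G \<Longrightarrow> clique_sum G \<in> {-1, 1}"
proof (induction rule: sphere_of_dim.induct)
  case empty
  show ?case by (simp add: clique_sum_empty)
next
  case (step d G)
  then obtain x where x: "x \<in> verts G" "contractible (remove_vertex G x)" by auto
  then have "clique_sum G = - clique_sum (unit_sphere G x)"
    using step clique_sum_remove_vertex clique_sum_contractible by fastforce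
  then show ?case using step x by auto
qed

section \<open>Joins\<close>

lemma verts_join: "verts (zykov_join G H) = verts G <+> verts H"
  by (simp add: zykov_join_def)

lemma doubleton_image: "inj f \<Longrightarrow> {f a, f b} \<in> (`) f ` E \<longleftrightarrow> {a, b} \<in> E"
  using inj_image_mem_iff[of "(`) f" "{a, b}" E] by (simp add: inj_image_eq_iff inj_def)

text \<open>Adjacency sorted by the tags of the endpoints; later adjacency computations in joins
  rest on these rules instead of the definition.\<close>

lemma edges_join [simp]:
  "{Inl a, Inl b} \<in> edges (zykov_join G H) \<longleftrightarrow> {a, b} \<in> edges G"
  "{Inr c, Inr d} \<in> edges (zykov_join G H) \<longleftrightarrow> {c, d} \<in> edges H"
  "{Inl a, Inr c} \<in> edges (zykov_join G H) \<longleftrightarrow> a \<in> verts G \<and> c \<in> verts H"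
  "{Inr c, Inl a} \<in> edges (zykov_join G H) \<longleftrightarrow> a \<in> verts G \<and> c \<in> verts H"
proof -
  show "{Inl a, Inl b} \<in> edges (zykov_join G H) \<longleftrightarrow> {a, b} \<in> edges G"
    using doubleton_image[OF inj_Inl, of a b "edges G"]
    by (auto simp: zykov_join_def doubleton_eq_iff)
  show "{Inr c, Inr d} \<in> edges (zykov_join G H) \<longleftrightarrow> {c, d} \<in> edges H"
    using doubleton_image[OF inj_Inr, of c d "edges H"]
    by (auto simp: zykov_join_def doubleton_eq_iff)
  show *: "{Inl a, Inr c} \<in> edges (zykov_join G H) \<longleftrightarrow> a \<in> verts G \<and> c \<in> verts H"
    by (auto simp: zykov_join_def doubleton_eq_iff)
  show "{Inr c, Inl a} \<in> edges (zykov_join G H) \<longleftrightarrow> a \<in> verts G \<and> c \<in> verts H"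
    using * by (simp add: insert_commute)
qed

text \<open>Edges of a simple graph are two-element sets of vertices, so the adjacency relation
  determines the edge set.\<close>

lemma graph_eqI:
  assumes "simple_graph G" "simple_graph H" "verts G = verts H"
    and "\<And>x y. x \<in> verts G \<Longrightarrow> y \<in> verts G \<Longrightarrow> {x, y} \<in> edges G \<longleftrightarrow> {x, y} \<in> edges H"
  shows "G = H"
proof -
  have "e \<in> edges G \<longleftrightarrow> e \<in> edges H" for e
  proof (cases "\<exists>x \<in> verts G. \<exists>y \<in> verts G. e = {x, y}")
    case True
    then show ?thesis using assms(4) by auto
  next
    case False
    then have "\<not> (e \<subseteq> verts G \<and> card e = 2)" by (auto simp: card_2_iff)
    then show ?thesis using assms by (auto simp: simple_graph_def)
  qed
  then show ?thesis using assms(3) by (cases G; cases H) auto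
qed

lemma simple_join:
  assumes "simple_graph G" "simple_graph H"
  shows "simple_graph (zykov_join G H)"
  unfolding simple_graph_def
proof (intro conjI ballI)
  show "finite (verts (zykov_join G H))" using assms by (simp add: simple_graph_def verts_join)
  fix e assume "e \<in> edges (zykov_join G H)"
  then consider a where "e = Inl ` a" "a \<in> edges G" | b where "e = Inr ` b" "b \<in> edges H"
    | x y where "e = {Inl x, Inr y}" "x \<in> verts G" "y \<in> verts H"
    by (auto simp: zykov_join_def)
  then have "e \<subseteq> verts (zykov_join G H) \<and> card e = 2"
    using assms by cases (auto simp: simple_graph_def verts_join card_image)
  then show "e \<subseteq> verts (zykov_join G H)" "card e = 2" by simp_all
qed

section \<open>Unit spheres and vertex deletions in a join\<close>

lemma verts_unit_sphere: "verts (unit_sphere G x) = {y \<in> verts G. {x, y} \<in> edges G}"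
  by (auto simp: unit_sphere_def)

lemma edges_unit_sphere:
  "{a, b} \<in> edges (unit_sphere G x) \<longleftrightarrow>
     {a, b} \<in> edges G \<and> {x, a} \<in> edges G \<and> {x, b} \<in> edges G"
  by (auto simp: unit_sphere_def)

lemma verts_remove_vertex: "verts (remove_vertex G x) = verts G - {x}"
  by (auto simp: remove_vertex_def)

lemma edges_remove_vertex:
  "simple_graph G \<Longrightarrow> {a, b} \<in> edges (remove_vertex G x) \<longleftrightarrow> {a, b} \<in> edges G \<and> a \<noteq> x \<and> b \<noteq> x"
  by (auto simp: remove_vertex_def dest: simple_edgeD)

text \<open>A vertex of the left factor is adjacent to its neighbors there and to all of
  \<open>H\<close>. The tags agree on both sides, so the graphs are equal and not merely isomorphic,
  which spares transport in the inductions.\<close>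

lemma unit_sphere_join_Inl:
  assumes "simple_graph G" "simple_graph H" "x \<in> verts G"
  shows "unit_sphere (zykov_join G H) (Inl x) = zykov_join (unit_sphere G x) H"
proof (rule graph_eqI)
  show eq: "verts (unit_sphere (zykov_join G H) (Inl x)) = verts (zykov_join (unit_sphere G x) H)"
    using assms(3) by (auto simp: verts_unit_sphere verts_join)
  fix a b assume "a \<in> verts (unit_sphere (zykov_join G H) (Inl x))"
    "b \<in> verts (unit_sphere (zykov_join G H) (Inl x))"
  then show "{a, b} \<in> edges (unit_sphere (zykov_join G H) (Inl x)) \<longleftrightarrow>
      {a, b} \<in> edges (zykov_join (unit_sphere G x) H)"
    using assms(3)
    by (cases a; cases b) (auto simp: verts_unit_sphere edges_unit_sphere verts_join)
qed (use assms in \<open>simp_all add: simple_join simple_unit_sphere\<close>)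

lemma unit_sphere_join_Inr:
  assumes "simple_graph G" "simple_graph H" "x \<in> verts H"
  shows "unit_sphere (zykov_join G H) (Inr x) = zykov_join G (unit_sphere H x)"
proof (rule graph_eqI)
  show eq: "verts (unit_sphere (zykov_join G H) (Inr x)) = verts (zykov_join G (unit_sphere H x))"
    using assms(3) by (auto simp: verts_unit_sphere verts_join)
  fix a b assume "a \<in> verts (unit_sphere (zykov_join G H) (Inr x))"
    "b \<in> verts (unit_sphere (zykov_join G H) (Inr x))"
  then show "{a, b} \<in> edges (unit_sphere (zykov_join G H) (Inr x)) \<longleftrightarrow>
      {a, b} \<in> edges (zykov_join G (unit_sphere H x))"
    using assms(3)
    by (cases a; cases b) (auto simp: verts_unit_sphere edges_unit_sphere verts_join)
qed (use assms in \<open>simp_all add: simple_join simple_unit_sphere\<close>)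

lemma remove_vertex_join_Inl:
  assumes "simple_graph G" "simple_graph H"
  shows "remove_vertex (zykov_join G H) (Inl x) = zykov_join (remove_vertex G x) H"
proof (rule graph_eqI)
  show eq: "verts (remove_vertex (zykov_join G H) (Inl x)) = verts (zykov_join (remove_vertex G x) H)"
    by (auto simp: verts_remove_vertex verts_join)
  fix a b assume "a \<in> verts (remove_vertex (zykov_join G H) (Inl x))"
    "b \<in> verts (remove_vertex (zykov_join G H) (Inl x))"
  then show "{a, b} \<in> edges (remove_vertex (zykov_join G H) (Inl x)) \<longleftrightarrow>
      {a, b} \<in> edges (zykov_join (remove_vertex G x) H)"
    using assms
    by (cases a; cases b)
      (auto simp: verts_remove_vertex edges_remove_vertex simple_join verts_join)
qed (use assms in \<open>simp_all add: simple_join simple_remove_vertex\<close>)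

lemma remove_vertex_join_Inr:
  assumes "simple_graph G" "simple_graph H"
  shows "remove_vertex (zykov_join G H) (Inr x) = zykov_join G (remove_vertex H x)"
proof (rule graph_eqI)
  show eq: "verts (remove_vertex (zykov_join G H) (Inr x)) = verts (zykov_join G (remove_vertex H x))"
    by (auto simp: verts_remove_vertex verts_join)
  fix a b assume "a \<in> verts (remove_vertex (zykov_join G H) (Inr x))"
    "b \<in> verts (remove_vertex (zykov_join G H) (Inr x))"
  then show "{a, b} \<in> edges (remove_vertex (zykov_join G H) (Inr x)) \<longleftrightarrow>
      {a, b} \<in> edges (zykov_join G (remove_vertex H x))"
    using assms
    by (cases a; cases b)
      (auto simp: verts_remove_vertex edges_remove_vertex simple_join verts_join)
qed (use assms in \<open>simp_all add: simple_join simple_remove_vertex\<close>)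

text \<open>A clique of the join splits uniquely into a clique of each factor. Sizes add, so signs
  multiply and the sum factors.\<close>

lemma clique_sum_join:
  assumes fin: "finite (verts G)" "finite (verts H)"
  shows "clique_sum (zykov_join G H) = clique_sum G * clique_sum H"
proof -
  let ?P = "\<lambda>(K, L). K <+> L"
  \<comment> \<open>All cross edges are present, so no condition links \<open>K\<close> with
    \<open>L\<close>.\<close>
  have clique: "K <+> L \<in> cliques (zykov_join G H) \<longleftrightarrow> K \<in> cliques G \<and> L \<in> cliques H" for K L
    by (auto simp: cliques_def verts_join Plus_def ball_Un subset_iff)
  have "cliques (zykov_join G H) = ?P ` (cliques G \<times> cliques H)"
  proof (intro equalityI subsetI)
    fix M assume M: "M \<in> cliques (zykov_join G H)"
    have "M = (Inl -` M) <+> (Inr -` M)"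
    proof (rule Set.set_eqI)
      fix z show "z \<in> M \<longleftrightarrow> z \<in> (Inl -` M) <+> (Inr -` M)" by (cases z) auto
    qed
    then show "M \<in> ?P ` (cliques G \<times> cliques H)"
      using M clique[of "Inl -` M" "Inr -` M"] by (auto intro!: rev_image_eqI)
  qed (use clique in auto)
  moreover have "inj_on ?P (cliques G \<times> cliques H)"
    \<comment> \<open>The preimages under the two tags recover the parts of a disjoint
      union.\<close>
    by (rule inj_on_inverseI[of _ "\<lambda>M. (Inl -` M, Inr -` M)"]) auto
  ultimately have "clique_sum (zykov_join G H) =
      (\<Sum>p \<in> cliques G \<times> cliques H. (-1) ^ card (?P p))"
    by (simp add: clique_sum_def sum.reindex)
  also have "\<dots> = (\<Sum>(K, L) \<in> cliques G \<times> cliques H. (-1) ^ card K * (-1) ^ card L)"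
  proof (rule sum.cong)
    fix p assume "p \<in> cliques G \<times> cliques H"
    then obtain K L where p: "p = (K, L)" "K \<subseteq> verts G" "L \<subseteq> verts H"
      by (auto simp: cliques_def)
    then have "card (K <+> L) = card K + card L"
      using fin finite_subset by (metis card_Plus)
    then show "(-1) ^ card (?P p) = (case p of (K, L) \<Rightarrow> (-1) ^ card K * (-1 :: int) ^ card L)"
      using p(1) by (simp add: power_add)
  qed simp
  also have "\<dots> = clique_sum G * clique_sum H"
    by (simp add: clique_sum_def sum_product sum.cartesian_product)
  finally show ?thesis .
qed

section \<open>The join up to isomorphism: congruence and monoid laws\<close>

lemma iso_map_join:
  assumes "iso_map f G G'" "iso_map g H H'"
  shows "iso_map (map_sum f g) (zykov_join G H) (zykov_join G' H')"
  unfolding iso_map_def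
proof (intro conjI ballI)
  have f: "bij_betw f (verts G) (verts G')" and g: "bij_betw g (verts H) (verts H')"
    using assms by (simp_all add: iso_map_def)
  have "inj_on (map_sum f g) (verts G <+> verts H)"
    using f g by (fastforce simp: bij_betw_def inj_on_def)
  moreover have "map_sum f g ` (verts G <+> verts H) = verts G' <+> verts H'"
    using f g by (force simp: bij_betw_def Plus_def image_Un image_image)
  ultimately show "bij_betw (map_sum f g) (verts (zykov_join G H)) (verts (zykov_join G' H'))"
    by (simp add: bij_betw_def verts_join)
  fix x y assume "x \<in> verts (zykov_join G H)" "y \<in> verts (zykov_join G H)"
  then show "{x, y} \<in> edges (zykov_join G H) \<longleftrightarrow>
      {map_sum f g x, map_sum f g y} \<in> edges (zykov_join G' H')"
    using assms f g
    by (cases x; cases y) (auto simp: verts_join iso_map_def bij_betw_def)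
qed

lemma graph_iso_join:
  "graph_iso G G' \<Longrightarrow> graph_iso H H' \<Longrightarrow> graph_iso (zykov_join G H) (zykov_join G' H')"
  unfolding graph_iso_iff using iso_map_join by blast

lemma graph_iso_join_comm: "graph_iso (zykov_join G H) (zykov_join H G)"
proof -
  let ?s = "case_sum Inr Inl"
  have "bij_betw ?s (verts G <+> verts H) (verts H <+> verts G)"
    by (rule bij_betw_byWitness[of _ "case_sum Inr Inl"]) auto
  then have "iso_map ?s (zykov_join G H) (zykov_join H G)"
    unfolding iso_map_def by (auto simp: verts_join)
  then show ?thesis unfolding graph_iso_iff by blast
qed

lemma graph_iso_join_assoc:
  "graph_iso (zykov_join (zykov_join G H) K) (zykov_join G (zykov_join H K))"
proof -
  let ?s = "case_sum (case_sum Inl (Inr \<circ> Inl)) (Inr \<circ> Inr)"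
  have "bij_betw ?s ((verts G <+> verts H) <+> verts K) (verts G <+> (verts H <+> verts K))"
    \<comment> \<open>The witness is the inverse rebracketing of the tags.\<close>
    by (rule bij_betw_byWitness[of _ "case_sum (Inl \<circ> Inl) (case_sum (Inl \<circ> Inr) Inr)"]) auto
  then have "iso_map ?s (zykov_join (zykov_join G H) K) (zykov_join G (zykov_join H K))"
    unfolding iso_map_def by (auto simp: verts_join)
  then show ?thesis unfolding graph_iso_iff by blast
qed

lemma iso_map_join_empty: "iso_map Inr H (zykov_join empty_graph H)"
  by (auto simp: iso_map_def verts_join empty_graph_def bij_betw_def)

text \<open>Induction on the number of vertices of the base. For a base vertex \<open>y\<close>,
  both the unit sphere of \<open>y\<close> in the cone and the cone without \<open>y\<close> are
  cones over smaller graphs; over the empty base the cone is one point.\<close>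

lemma contractible_cone: "simple_graph H \<Longrightarrow> contractible (zykov_join (SGraph {x} {}) H)"
proof (induction "card (verts H)" arbitrary: H rule: less_induct)
  case less
  let ?P = "SGraph {x} {}"
  have P: "simple_graph ?P" by (simp add: simple_graph_def)
  have fin: "finite (verts H)" using less.prems by (simp add: simple_graph_def)
  show ?case
  proof (cases "verts H = {}")
    case True
    then have "zykov_join ?P H = SGraph {Inl x} {}"
      using single_vertex_graph[OF simple_join[OF P less.prems]] by (auto simp: verts_join)
    then show ?thesis by (simp add: contractible.one_point)
  next
    case False
    then obtain y where y: "y \<in> verts H" by blast
    \<comment> \<open>Absence of loops makes the unit sphere of \<open>y\<close> a proper part of
      \<open>H\<close>, as the induction requires.\<close>
    have "y \<notin> verts (unit_sphere H y)"
      using simple_edgeD(3)[OF less.prems, of y y] by (auto simp: verts_unit_sphere)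
    moreover have "verts (unit_sphere H y) \<subseteq> verts H" by (auto simp: verts_unit_sphere)
    ultimately have sub: "verts (unit_sphere H y) \<subset> verts H" "verts (remove_vertex H y) \<subset> verts H"
      using y by (blast, auto simp: verts_remove_vertex)
    have "contractible (zykov_join ?P (unit_sphere H y))"
      "contractible (zykov_join ?P (remove_vertex H y))"
      using sub less.prems
      by (auto intro!: less.hyps psubset_card_mono[OF fin] simple_unit_sphere simple_remove_vertex)
    then show ?thesis
      using contractible.extend[of "zykov_join ?P H" "Inr y"] y
      by (simp add: P less.prems simple_join unit_sphere_join_Inr remove_vertex_join_Inr verts_join InrI)
  qed
qed

text \<open>Induction on the contraction of \<open>G\<close>: taking unit sphere or deletion at a
  left vertex acts on the left factor alone, and the process ends with a cone over
  \<open>H\<close>.\<close>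

lemma contractible_join:
  assumes "contractible G" "simple_graph H"
  shows "contractible (zykov_join G H)"
  using assms(1)
proof (induction rule: contractible.induct)
  case (one_point x)
  show ?case by (rule contractible_cone[OF assms(2)])
next
  case (extend G x)
  then show ?case
    using contractible.extend[of "zykov_join G H" "Inl x"] assms(2)
    by (simp add: simple_join unit_sphere_join_Inl remove_vertex_join_Inl verts_join InlI)
qed

text \<open>A nested induction: unit spheres at vertices of \<open>G\<close> shrink the left factor
  and fall under the outer hypothesis, those at vertices of \<open>H\<close> shrink the right one
  and fall under the inner. The summand 1 in the dimension makes the (-1)-sphere neutral.\<close>

lemma sphere_of_dim_join:
  fixes G :: "'a sgraph" and H :: "'b sgraph"
  assumes "sphere_of_dim d G" "sphere_of_dim e H"
  shows "sphere_of_dim (d + e + 1) (zykov_join G H)"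
  using assms
proof (induction arbitrary: e H rule: sphere_of_dim.induct)
  case empty
  have "simple_graph (zykov_join (empty_graph :: 'a sgraph) H)"
    using sphere_of_dim_simple[OF empty] by (intro simple_join) (auto simp: simple_graph_def empty_graph_def)
  then show ?case using sphere_of_dim_iso[OF empty iso_map_join_empty] by simp
next
  case (step d G)
  \<comment> \<open>The inner induction runs over \<open>H\<close> with \<open>G\<close> fixed; the
    outer hypothesis holds for arbitrary \<open>e\<close> and \<open>H\<close>, so it remains usable
    inside.\<close>
  from step.prems show ?case
  proof (induction rule: sphere_of_dim.induct)
    case empty
    have G: "sphere_of_dim d G" using step by (intro sphere_of_dim.step) auto
    have simple: "simple_graph (zykov_join G (empty_graph :: 'b sgraph))"
      using step by (intro simple_join) (auto simp: simple_graph_def empty_graph_def)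
    have "graph_iso G (zykov_join (empty_graph :: 'b sgraph) G)"
      using iso_map_join_empty unfolding graph_iso_iff by blast
    then have "graph_iso G (zykov_join G (empty_graph :: 'b sgraph))"
      using graph_iso_join_comm graph_iso_trans by blast
    then show ?case using sphere_of_dim_iso[OF G _ simple] unfolding graph_iso_iff by auto
  next
    case inner: (step e H)
    have H: "sphere_of_dim e H" using inner by (intro sphere_of_dim.step) auto
    show ?case
    proof (rule sphere_of_dim.step)
      show "0 \<le> d + e + 1" using step inner by simp
      show "simple_graph (zykov_join G H)" using step inner by (simp add: simple_join)
      show "\<forall>x \<in> verts (zykov_join G H).
          sphere_of_dim (d + e + 1 - 1) (unit_sphere (zykov_join G H) x)"
      proof
        fix z assume "z \<in> verts (zykov_join G H)"
        then consider x where "z = Inl x" "x \<in> verts G" | y where "z = Inr y" "y \<in> verts H"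
          by (auto simp: verts_join)
        then show "sphere_of_dim (d + e + 1 - 1) (unit_sphere (zykov_join G H) z)"
        proof cases
          case 1
          then have "sphere_of_dim (d - 1 + e + 1) (zykov_join (unit_sphere G x) H)"
            using step.IH H by blast
          then show ?thesis
            using 1 step.hyps inner.hyps by (simp add: unit_sphere_join_Inl algebra_simps)
        next
          case 2
          then have "sphere_of_dim (d + (e - 1) + 1) (zykov_join G (unit_sphere H y))"
            using inner.IH by blast
          then show ?thesis
            using 2 step.hyps inner.hyps by (simp add: unit_sphere_join_Inr algebra_simps)
        qed
      qed
      \<comment> \<open>A single vertex with contractible deletion suffices, and one from
        \<open>G\<close> works because a contractible factor makes the whole join
        contractible.\<close>
      obtain x where "x \<in> verts G" "contractible (remove_vertex G x)" using step by blast
      then have "Inl x \<in> verts (zykov_join G H)"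
        "contractible (remove_vertex (zykov_join G H) (Inl x))"
        using contractible_join step.hyps inner.hyps
        by (auto simp: remove_vertex_join_Inl verts_join)
      then show "\<exists>z \<in> verts (zykov_join G H). contractible (remove_vertex (zykov_join G H) z)"
        by blast
    qed
  qed
qed

lemma is_sphere_join: "is_sphere G \<Longrightarrow> is_sphere H \<Longrightarrow> is_sphere (zykov_join G H)"
  unfolding is_sphere_def using sphere_of_dim_join by blast

text \<open>\<open>iso_class\<close> admits only graphs on natural numbers. The copy shows that the
  class is nonempty for a simple graph on any vertex type, such as a join with its sum type.\<close>

lemma nat_copy:
  fixes G :: "'a sgraph"
  assumes "simple_graph G"
  obtains K :: "nat sgraph" where "simple_graph K" "graph_iso G K"
proof -
  have "finite (verts G)" using assms by (simp add: simple_graph_def)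
  then obtain f :: "'a \<Rightarrow> nat" where f: "inj_on f (verts G)"
    using finite_imp_inj_to_nat_seg by blast
  let ?K = "SGraph (f ` verts G) ((`) f ` edges G)"
  have sub: "e \<subseteq> verts G" "card e = 2" if "e \<in> edges G" for e
    using assms that by (auto simp: simple_graph_def)
  have "card (f ` e) = 2" if "e \<in> edges G" for e
    using sub[OF that] f by (metis card_image inj_on_subset)
  then have "simple_graph ?K"
    using assms sub by (auto simp: simple_graph_def)
  moreover have "{f x, f y} \<in> (`) f ` edges G \<longleftrightarrow> {x, y} \<in> edges G"
    if "x \<in> verts G" "y \<in> verts G" for x y
  proof
    assume "{f x, f y} \<in> (`) f ` edges G"
    then obtain e where e: "e \<in> edges G" "f ` {x, y} = f ` e" by auto
    then have "{x, y} = e"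
      using inj_on_image_eq_iff[OF f, of "{x, y}" e] sub that by simp
    then show "{x, y} \<in> edges G" using e by simp
  next
    assume "{x, y} \<in> edges G"
    then have "f ` {x, y} \<in> (`) f ` edges G" by (rule imageI)
    then show "{f x, f y} \<in> (`) f ` edges G" by simp
  qed
  then have "graph_iso G ?K"
    unfolding graph_iso_def using f by (intro exI[of _ f]) (auto simp: bij_betw_def)
  ultimately show ?thesis by (rule that)
qed

section \<open>The Grothendieck group and its universal property\<close>

context comm_monoid
begin

lemma grothendieck_rel_iff:
  "((a, b), (c, d)) \<in> grothendieck_rel G \<longleftrightarrow>
     a \<in> carrier G \<and> b \<in> carrier G \<and> c \<in> carrier G \<and> d \<in> carrier G \<and>
     (\<exists>k \<in> carrier G. a \<otimes> d \<otimes> k = b \<otimes> c \<otimes> k)"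
  by (simp add: grothendieck_rel_def)

text \<open>The monoid need not be cancellative, so the middle pair cannot be removed; it is
  absorbed, with both old stabilizing elements, into the new one.\<close>

lemma grothendieck_rel_trans:
  assumes "((a, b), (c, d)) \<in> grothendieck_rel G" "((c, d), (e, f)) \<in> grothendieck_rel G"
  shows "((a, b), (e, f)) \<in> grothendieck_rel G"
proof -
  obtain k where k: "k \<in> carrier G" "a \<otimes> d \<otimes> k = b \<otimes> c \<otimes> k"
    using assms(1) by (auto simp: grothendieck_rel_iff)
  obtain l where l: "l \<in> carrier G" "c \<otimes> f \<otimes> l = d \<otimes> e \<otimes> l"
    using assms(2) by (auto simp: grothendieck_rel_iff)
  have cl: "a \<in> carrier G" "b \<in> carrier G" "c \<in> carrier G" "d \<in> carrier G"
    "e \<in> carrier G" "f \<in> carrier G"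
    using assms by (auto simp: grothendieck_rel_iff)
  have "a \<otimes> f \<otimes> (c \<otimes> d \<otimes> k \<otimes> l) = (a \<otimes> d \<otimes> k) \<otimes> (c \<otimes> f \<otimes> l)"
    using cl k(1) l(1) by (simp add: m_ac)
  also have "\<dots> = (b \<otimes> c \<otimes> k) \<otimes> (d \<otimes> e \<otimes> l)" by (simp only: k l)
  also have "\<dots> = b \<otimes> e \<otimes> (c \<otimes> d \<otimes> k \<otimes> l)"
    using cl k(1) l(1) by (simp add: m_ac)
  finally have "\<exists>m \<in> carrier G. a \<otimes> f \<otimes> m = b \<otimes> e \<otimes> m"
    using cl k(1) l(1) by (intro bexI[of _ "c \<otimes> d \<otimes> k \<otimes> l"]) auto
  then show ?thesis using cl by (simp add: grothendieck_rel_iff)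
qed

lemma equiv_grothendieck_rel: "equiv (carrier G \<times> carrier G) (grothendieck_rel G)"
proof (rule equivI)
  show "grothendieck_rel G \<subseteq> (carrier G \<times> carrier G) \<times> (carrier G \<times> carrier G)"
    by (auto simp: grothendieck_rel_def)
  show "refl_on (carrier G \<times> carrier G) (grothendieck_rel G)"
    by (auto simp: refl_on_def grothendieck_rel_iff m_comm)
  show "sym (grothendieck_rel G)"
    unfolding sym_def by (auto simp: grothendieck_rel_iff) (metis m_comm)
  show "trans (grothendieck_rel G)"
    unfolding trans_def using grothendieck_rel_trans by fast
qed

lemma formal_difference_eq_iff:
  assumes "a \<in> carrier G" "b \<in> carrier G" "c \<in> carrier G" "d \<in> carrier G"
  shows "formal_difference G a b = formal_difference G c d \<longleftrightarrow>
    (\<exists>k \<in> carrier G. a \<otimes> d \<otimes> k = b \<otimes> c \<otimes> k)"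
  unfolding formal_difference_def
  using eq_equiv_class_iff[OF equiv_grothendieck_rel, of "(a, b)" "(c, d)"] assms
  by (simp add: grothendieck_rel_iff)

lemma carrier_grothendieck_group:
  "carrier (grothendieck_group G) =
     {formal_difference G a b | a b. a \<in> carrier G \<and> b \<in> carrier G}"
  by (auto simp: grothendieck_group_def quotient_def formal_difference_def)

lemma formal_difference_closed:
  "a \<in> carrier G \<Longrightarrow> b \<in> carrier G \<Longrightarrow>
     formal_difference G a b \<in> carrier (grothendieck_group G)"
  unfolding carrier_grothendieck_group by blast

lemma formal_difference_self:
  "a \<in> carrier G \<Longrightarrow> b \<in> carrier G \<Longrightarrow> (a, b) \<in> formal_difference G a b"
  by (auto simp: formal_difference_def grothendieck_rel_iff m_comm)

lemma mem_formal_differenceD: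
  assumes "(c, d) \<in> formal_difference G a b"
  shows "a \<in> carrier G" "b \<in> carrier G" "c \<in> carrier G" "d \<in> carrier G"
    "\<exists>k \<in> carrier G. a \<otimes> d \<otimes> k = b \<otimes> c \<otimes> k"
  using assms by (auto simp: formal_difference_def grothendieck_rel_iff)

text \<open>Multiplying the two given relations gives the required one, with the product
  \<open>k \<otimes> l\<close> as stabilizing element.\<close>

lemma formal_difference_mult_cong:
  assumes "(a', b') \<in> formal_difference G a b" "(c', d') \<in> formal_difference G c d"
  shows "formal_difference G (a' \<otimes> c') (b' \<otimes> d') = formal_difference G (a \<otimes> c) (b \<otimes> d)"
proof -
  note cl = mem_formal_differenceD(1-4)[OF assms(1)] mem_formal_differenceD(1-4)[OF assms(2)]
  obtain k where k: "k \<in> carrier G" "a \<otimes> b' \<otimes> k = b \<otimes> a' \<otimes> k"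
    using mem_formal_differenceD(5)[OF assms(1)] by blast
  obtain l where l: "l \<in> carrier G" "c \<otimes> d' \<otimes> l = d \<otimes> c' \<otimes> l"
    using mem_formal_differenceD(5)[OF assms(2)] by blast
  have "(a' \<otimes> c') \<otimes> (b \<otimes> d) \<otimes> (k \<otimes> l) = (b \<otimes> a' \<otimes> k) \<otimes> (d \<otimes> c' \<otimes> l)"
    using cl k(1) l(1) by (simp add: m_ac)
  also have "\<dots> = (a \<otimes> b' \<otimes> k) \<otimes> (c \<otimes> d' \<otimes> l)" by (simp only: k l)
  also have "\<dots> = (b' \<otimes> d') \<otimes> (a \<otimes> c) \<otimes> (k \<otimes> l)"
    using cl k(1) l(1) by (simp add: m_ac)
  finally show ?thesis
    using cl k(1) l(1) formal_difference_eq_iff[of "a' \<otimes> c'" "b' \<otimes> d'" "a \<otimes> c" "b \<otimes> d"]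
    by (metis m_closed)
qed

lemma formal_difference_mult:
  assumes "a \<in> carrier G" "b \<in> carrier G" "c \<in> carrier G" "d \<in> carrier G"
  shows "formal_difference G a b \<otimes>\<^bsub>grothendieck_group G\<^esub> formal_difference G c d =
    formal_difference G (a \<otimes> c) (b \<otimes> d)"
proof -
  have "(\<Union>(a', b') \<in> formal_difference G a b. \<Union>(c', d') \<in> formal_difference G c d.
      formal_difference G (a' \<otimes> c') (b' \<otimes> d')) =
    (\<Union>p \<in> formal_difference G a b. \<Union>q \<in> formal_difference G c d.
      formal_difference G (a \<otimes> c) (b \<otimes> d))"
    using formal_difference_mult_cong by (intro SUP_cong refl) (auto intro!: SUP_cong)
  \<comment> \<open>The union of equal sets collapses to that set because the index sets are
    nonempty: each class contains its own pair.\<close>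
  also have "\<dots> = formal_difference G (a \<otimes> c) (b \<otimes> d)"
    using formal_difference_self[OF assms(1,2)] formal_difference_self[OF assms(3,4)] by blast
  finally show ?thesis by (simp add: grothendieck_group_def)
qed

lemma one_grothendieck_group: "\<one>\<^bsub>grothendieck_group G\<^esub> = formal_difference G \<one> \<one>"
  by (simp add: grothendieck_group_def)

lemma group_grothendieck_group: "group (grothendieck_group G)"
proof (rule groupI)
  let ?K = "grothendieck_group G"
  show "\<one>\<^bsub>?K\<^esub> \<in> carrier ?K"
    by (simp add: one_grothendieck_group formal_difference_closed)
  fix X assume "X \<in> carrier ?K"
  then obtain a b where X: "X = formal_difference G a b" "a \<in> carrier G" "b \<in> carrier G"
    by (auto simp: carrier_grothendieck_group)
  show "\<one>\<^bsub>?K\<^esub> \<otimes>\<^bsub>?K\<^esub> X = X"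
    using X by (simp add: one_grothendieck_group formal_difference_mult)
  \<comment> \<open>The inverse of a difference is the difference with its entries swapped.\<close>
  have "formal_difference G (b \<otimes> a) (a \<otimes> b) = formal_difference G \<one> \<one>"
    using X by (subst formal_difference_eq_iff) (auto simp: m_comm)
  then show "\<exists>Y \<in> carrier ?K. Y \<otimes>\<^bsub>?K\<^esub> X = \<one>\<^bsub>?K\<^esub>"
    using X formal_difference_closed formal_difference_mult one_grothendieck_group by metis
  fix Y assume "Y \<in> carrier ?K"
  then obtain c d where Y: "Y = formal_difference G c d" "c \<in> carrier G" "d \<in> carrier G"
    by (auto simp: carrier_grothendieck_group)
  show "X \<otimes>\<^bsub>?K\<^esub> Y \<in> carrier ?K"
    using X Y by (simp add: formal_difference_mult formal_difference_closed)
  fix Z assume "Z \<in> carrier ?K"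
  then obtain e f where Z: "Z = formal_difference G e f" "e \<in> carrier G" "f \<in> carrier G"
    by (auto simp: carrier_grothendieck_group)
  show "X \<otimes>\<^bsub>?K\<^esub> Y \<otimes>\<^bsub>?K\<^esub> Z = X \<otimes>\<^bsub>?K\<^esub> (Y \<otimes>\<^bsub>?K\<^esub> Z)"
    using X Y Z by (simp add: formal_difference_mult m_assoc)
qed

text \<open>Existence half of the universal property: the target group is cancellative, so the
  stabilizing element disappears and the quotient of the values depends only on the class.\<close>

lemma grothendieck_group_extension:
  assumes "comm_group K" and \<phi>: "\<phi> \<in> hom G K"
  obtains h where "group_hom (grothendieck_group G) K h"
    "\<And>a b. a \<in> carrier G \<Longrightarrow> b \<in> carrier G \<Longrightarrow>
       h (formal_difference G a b) = \<phi> a \<otimes>\<^bsub>K\<^esub> inv\<^bsub>K\<^esub> \<phi> b"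
proof -
  interpret K: comm_group K by fact
  have cl: "\<phi> a \<in> carrier K" if "a \<in> carrier G" for a
    using \<phi> that by (auto simp: hom_def)
  have mult: "\<phi> (a \<otimes> b) = \<phi> a \<otimes>\<^bsub>K\<^esub> \<phi> b" if "a \<in> carrier G" "b \<in> carrier G" for a b
    using \<phi> that by (auto simp: hom_def)
  have wd: "\<phi> c \<otimes>\<^bsub>K\<^esub> inv\<^bsub>K\<^esub> \<phi> d = \<phi> a \<otimes>\<^bsub>K\<^esub> inv\<^bsub>K\<^esub> \<phi> b"
    if cd: "(c, d) \<in> formal_difference G a b" for a b c d
  proof -
    note abcd = mem_formal_differenceD(1-4)[OF cd]
    obtain k where k: "k \<in> carrier G" "a \<otimes> d \<otimes> k = b \<otimes> c \<otimes> k"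
      using mem_formal_differenceD(5)[OF cd] by blast
    then have "\<phi> a \<otimes>\<^bsub>K\<^esub> \<phi> d \<otimes>\<^bsub>K\<^esub> \<phi> k = \<phi> b \<otimes>\<^bsub>K\<^esub> \<phi> c \<otimes>\<^bsub>K\<^esub> \<phi> k"
      using abcd mult by (metis m_closed)
    \<comment> \<open>Here \<phi> k is cancelled in \<open>K\<close>.\<close>
    then have eq: "\<phi> a \<otimes>\<^bsub>K\<^esub> \<phi> d = \<phi> b \<otimes>\<^bsub>K\<^esub> \<phi> c" using abcd k(1) cl by simp
    have "\<phi> c = inv\<^bsub>K\<^esub> \<phi> b \<otimes>\<^bsub>K\<^esub> (\<phi> b \<otimes>\<^bsub>K\<^esub> \<phi> c)"
      using abcd cl by (simp flip: K.m_assoc)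
    also have "\<dots> = (\<phi> a \<otimes>\<^bsub>K\<^esub> inv\<^bsub>K\<^esub> \<phi> b) \<otimes>\<^bsub>K\<^esub> \<phi> d"
      using abcd cl by (simp add: K.m_ac flip: eq)
    finally show ?thesis using abcd cl by (simp add: K.m_assoc)
  qed
  \<comment> \<open>The value is computed from an arbitrarily chosen representative;
    \<open>wd\<close> shows that the choice does not matter.\<close>
  define h where "h X = (case SOME p. p \<in> X of (c, d) \<Rightarrow> \<phi> c \<otimes>\<^bsub>K\<^esub> inv\<^bsub>K\<^esub> \<phi> d)" for X
  have h: "h (formal_difference G a b) = \<phi> a \<otimes>\<^bsub>K\<^esub> inv\<^bsub>K\<^esub> \<phi> b"
    if "a \<in> carrier G" "b \<in> carrier G" for a b
  proof -
    have "(SOME p. p \<in> formal_difference G a b) \<in> formal_difference G a b"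
      using formal_difference_self[OF that] by (rule someI)
    then show ?thesis unfolding h_def using wd by (auto split: prod.split)
  qed
  have "h \<in> hom (grothendieck_group G) K"
  proof (rule homI)
    fix X assume "X \<in> carrier (grothendieck_group G)"
    then obtain a b where X: "X = formal_difference G a b" "a \<in> carrier G" "b \<in> carrier G"
      by (auto simp: carrier_grothendieck_group)
    then show "h X \<in> carrier K" using h cl by simp
    fix Y assume "Y \<in> carrier (grothendieck_group G)"
    then obtain c d where Y: "Y = formal_difference G c d" "c \<in> carrier G" "d \<in> carrier G"
      by (auto simp: carrier_grothendieck_group)
    show "h (X \<otimes>\<^bsub>grothendieck_group G\<^esub> Y) = h X \<otimes>\<^bsub>K\<^esub> h Y"
      using X Y cl by (simp add: formal_difference_mult h mult K.inv_mult K.m_ac)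
  qed
  then have "group_hom (grothendieck_group G) K h"
    by (simp add: group_hom_def group_hom_axioms_def group_grothendieck_group K.is_group)
  then show ?thesis using that h by blast
qed

end

section \<open>The sphere group\<close>

lemma iso_class_cong: "graph_iso G H \<Longrightarrow> iso_class G = iso_class H"
  unfolding iso_class_def by (metis graph_iso_sym graph_iso_trans)

lemma is_sphere_simple: "is_sphere G \<Longrightarrow> simple_graph G"
  unfolding is_sphere_def using sphere_of_dim_simple by blast

text \<open>The carrier mentions only spheres on natural numbers, so \<open>G\<close> is replaced by
  a copy of that type, which is again a sphere with the same class.\<close>

lemma iso_class_in_carrier:
  assumes "is_sphere G"
  shows "iso_class G \<in> carrier sphere_monoid"
proof -
  obtain K :: "nat sgraph" where "simple_graph K" "graph_iso G K"
    using nat_copy is_sphere_simple[OF assms] by blast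
  then have "is_sphere K" "iso_class G = iso_class K"
    using is_sphere_iso[OF assms] iso_class_cong by blast+
  then show ?thesis by (auto simp: sphere_monoid_def)
qed

lemma carrier_sphere_monoidE:
  assumes "X \<in> carrier sphere_monoid"
  obtains G :: "nat sgraph" where "is_sphere G" "X = iso_class G"
  using assms by (auto simp: sphere_monoid_def)

text \<open>Joins of members of the two classes are all isomorphic to the join of \<open>G\<close>
  and \<open>H\<close>, and both classes are nonempty, so the defining union is a single
  class.\<close>

lemma mult_sphere_monoid:
  assumes "is_sphere G" "is_sphere H"
  shows "iso_class G \<otimes>\<^bsub>sphere_monoid\<^esub> iso_class H = iso_class (zykov_join G H)"
proof -
  obtain G' H' :: "nat sgraph" where *: "simple_graph G'" "graph_iso G G'" "simple_graph H'" "graph_iso H H'"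
    using nat_copy is_sphere_simple assms by metis
  then have ne: "G' \<in> iso_class G" "H' \<in> iso_class H" by (simp_all add: iso_class_def)
  have "iso_class (zykov_join A B) = iso_class (zykov_join G H)"
    if "A \<in> iso_class G" "B \<in> iso_class H" for A B
    using iso_class_cong[OF graph_iso_join[of G A H B]] that by (simp add: iso_class_def)
  then have "(\<Union>A \<in> iso_class G. \<Union>B \<in> iso_class H. iso_class (zykov_join A B)) =
      (\<Union>A \<in> iso_class G. \<Union>B \<in> iso_class H. iso_class (zykov_join G H))"
    by simp
  also have "\<dots> = iso_class (zykov_join G H)" using ne by blast
  finally show ?thesis by (simp add: sphere_monoid_def)
qed

lemma one_sphere_monoid: "\<one>\<^bsub>sphere_monoid\<^esub> = iso_class (empty_graph :: nat sgraph)"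
  by (simp add: sphere_monoid_def)

lemma is_sphere_empty: "is_sphere empty_graph"
  unfolding is_sphere_def using sphere_of_dim.empty by blast

lemma comm_monoid_sphere_monoid: "comm_monoid sphere_monoid"
proof (rule comm_monoidI)
  let ?M = sphere_monoid
  show "\<one>\<^bsub>?M\<^esub> \<in> carrier ?M"
    by (simp add: one_sphere_monoid iso_class_in_carrier is_sphere_empty)
  fix X assume "X \<in> carrier ?M"
  then obtain G :: "nat sgraph" where X: "is_sphere G" "X = iso_class G"
    by (rule carrier_sphere_monoidE)
  have "iso_class (zykov_join (empty_graph :: nat sgraph) G) = iso_class G"
    using iso_map_join_empty graph_iso_sym unfolding graph_iso_iff
    by (metis graph_iso_iff iso_class_cong)
  then show "\<one>\<^bsub>?M\<^esub> \<otimes>\<^bsub>?M\<^esub> X = X"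
    using X by (simp add: one_sphere_monoid mult_sphere_monoid is_sphere_empty)
  fix Y assume "Y \<in> carrier ?M"
  then obtain H :: "nat sgraph" where Y: "is_sphere H" "Y = iso_class H"
    by (rule carrier_sphere_monoidE)
  show "X \<otimes>\<^bsub>?M\<^esub> Y \<in> carrier ?M"
    using X Y by (simp add: mult_sphere_monoid iso_class_in_carrier is_sphere_join)
  show "X \<otimes>\<^bsub>?M\<^esub> Y = Y \<otimes>\<^bsub>?M\<^esub> X"
    using X Y iso_class_cong[OF graph_iso_join_comm] by (metis mult_sphere_monoid)
  fix Z assume "Z \<in> carrier ?M"
  then obtain K :: "nat sgraph" where Z: "is_sphere K" "Z = iso_class K"
    by (rule carrier_sphere_monoidE)
  show "X \<otimes>\<^bsub>?M\<^esub> Y \<otimes>\<^bsub>?M\<^esub> Z = X \<otimes>\<^bsub>?M\<^esub> (Y \<otimes>\<^bsub>?M\<^esub> Z)"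
    using X Y Z iso_class_cong[OF graph_iso_join_assoc]
    by (simp add: mult_sphere_monoid is_sphere_join)
qed

section \<open>The functional i on spheres and on their classes\<close>

lemma i_functional_sphere_eq:
  "is_sphere G \<Longrightarrow> i_functional G = clique_sum G"
  using is_sphere_simple i_functional_eq_clique_sum by (auto simp: simple_graph_def)

lemma i_functional_sphere: "is_sphere G \<Longrightarrow> i_functional G \<in> {-1, 1}"
  using i_functional_sphere_eq clique_sum_sphere by (metis is_sphere_def)

lemma i_functional_join:
  assumes "is_sphere G" "is_sphere H"
  shows "i_functional (zykov_join G H) = i_functional G * i_functional H"
proof -
  have "finite (verts G)" "finite (verts H)"
    using assms[THEN is_sphere_simple] by (simp_all add: simple_graph_def)
  then show ?thesis
    using assms by (simp add: i_functional_sphere_eq is_sphere_join clique_sum_join)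
qed

text \<open>The choice of a member is harmless on classes of spheres, since i is invariant under
  isomorphism.\<close>

definition class_i :: "nat sgraph set \<Rightarrow> int" where
  "class_i X = i_functional (SOME G. G \<in> X)"

lemma class_i_iso_class:
  assumes "is_sphere G"
  shows "class_i (iso_class G) = i_functional G"
proof -
  obtain K :: "nat sgraph" where "simple_graph K" "graph_iso G K"
    using nat_copy is_sphere_simple[OF assms] by blast
  then have "\<exists>A. A \<in> iso_class G" by (auto simp: iso_class_def)
  then have "(SOME A. A \<in> iso_class G) \<in> iso_class G" by (rule someI_ex)
  moreover have "i_functional A = i_functional G" if "A \<in> iso_class G" for A
  proof -
    have "is_sphere A" "graph_iso G A"
      using that is_sphere_iso[OF assms] by (auto simp: iso_class_def)
    then show ?thesis
      using assms clique_sum_iso by (metis graph_iso_iff i_functional_sphere_eq)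
  qed
  ultimately show ?thesis by (simp add: class_i_def)
qed

lemma class_i_hom: "class_i \<in> hom sphere_monoid sign_img"
proof (rule homI)
  fix X assume "X \<in> carrier sphere_monoid"
  then obtain G :: "nat sgraph" where X: "is_sphere G" "X = iso_class G"
    by (rule carrier_sphere_monoidE)
  then show "class_i X \<in> carrier sign_img"
    using i_functional_sphere by (simp add: class_i_iso_class sign_img_def)
  fix Y assume "Y \<in> carrier sphere_monoid"
  then obtain H :: "nat sgraph" where Y: "is_sphere H" "Y = iso_class H"
    by (rule carrier_sphere_monoidE)
  show "class_i (X \<otimes>\<^bsub>sphere_monoid\<^esub> Y) = class_i X \<otimes>\<^bsub>sign_img\<^esub> class_i Y"
    using X Y by (simp add: mult_sphere_monoid class_i_iso_class is_sphere_join
        i_functional_join sign_img_def)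
qed

lemma comm_group_sign_img: "comm_group sign_img"
  by (rule group.group_comm_groupI[OF sign_img_is_group]) (simp add: sign_img_def)

text \<open>Both signs square to one.\<close>

lemma inv_sign_img:
  assumes "s \<in> {-1, 1}"
  shows "inv\<^bsub>sign_img\<^esub> s = s"
  using assms by (intro group.inv_equality[OF sign_img_is_group]) (auto simp: sign_img_def)

text \<open>Well-definedness is contained in \<open>h\<close> being a function of the class. The
  quotient is taken in the rationals to have genuine division, and the last conjunct is the
  extension of i along the map sending G to G - 0.\<close>

theorem corollary6:
  shows "\<exists>h :: (nat sgraph set \<times> nat sgraph set) set \<Rightarrow> int.
    group_hom sphere_group sign_img h \<and>
    (\<forall>(G :: nat sgraph) (H :: nat sgraph). is_sphere G \<and> is_sphere H \<longrightarrow>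
       rat_of_int (h (sphere_diff G H))
         = rat_of_int (i_functional G) / rat_of_int (i_functional H)) \<and>
    (\<forall>G :: nat sgraph. is_sphere G \<longrightarrow>
       h (sphere_diff G (empty_graph :: nat sgraph)) = i_functional G)"
proof -
  obtain h where h: "group_hom (grothendieck_group sphere_monoid) sign_img h"
    "\<And>X Y. X \<in> carrier sphere_monoid \<Longrightarrow> Y \<in> carrier sphere_monoid \<Longrightarrow>
       h (formal_difference sphere_monoid X Y) =
         class_i X \<otimes>\<^bsub>sign_img\<^esub> inv\<^bsub>sign_img\<^esub> class_i Y"
    using comm_monoid.grothendieck_group_extension[OF comm_monoid_sphere_monoid
        comm_group_sign_img class_i_hom] by blast
  \<comment> \<open>Signs are their own inverses, so the quotient can be computed as an integer
    product.\<close>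
  have diff: "h (sphere_diff G H) = i_functional G * i_functional H"
    if "is_sphere G" "is_sphere H" for G H :: "nat sgraph"
  proof -
    have "inv\<^bsub>sign_img\<^esub> i_functional H = i_functional H"
      by (rule inv_sign_img[OF i_functional_sphere[OF that(2)]])
    then have "h (sphere_diff G H) = i_functional G \<otimes>\<^bsub>sign_img\<^esub> i_functional H"
      using that h(2) by (simp add: sphere_diff_def iso_class_in_carrier class_i_iso_class)
    then show ?thesis by (simp add: sign_img_def)
  qed
  have "rat_of_int (h (sphere_diff G H)) = rat_of_int (i_functional G) / rat_of_int (i_functional H)"
    if "is_sphere G" "is_sphere H" for G H :: "nat sgraph"
    using diff[OF that] i_functional_sphere[OF that(2)] by auto
  moreover have "h (sphere_diff G (empty_graph :: nat sgraph)) = i_functional G"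
    if "is_sphere G" for G :: "nat sgraph"
  proof -
    \<comment> \<open>The empty graph has value 1, so subtracting it leaves i unchanged.\<close>
    have "i_functional (empty_graph :: nat sgraph) = 1"
      by (simp add: i_functional_sphere_eq is_sphere_empty clique_sum_empty)
    then show ?thesis using diff[OF that is_sphere_empty] by simp
  qed
  ultimately show ?thesis using h(1) unfolding sphere_group_def by blast
qed

end
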